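(* Let $X$ be a nonempty closed and convex subset of a uniformly convex normed space $(\widetilde{X},|\cdot|)$, let $K$ be a set (possibly infinite) with at least two elements, and let $(P_k)_{k\in K}$ be a tuple of nonempty subsets of $X$ which are positively separated, that is, $\inf\{d(P_k,P_j): j,k\in K,\ j\neq k\}>0$. Assume that there exists $\rho\in(0,\infty)$ such that for each $k\in K$ and each $x\in X$ the open ball $B(x,\rho)$ intersects $A_k=\bigcup_{j\neq k}P_j$. Suppose that for each $x\in X$ and each $k\in K$ the distance between $x$ and $P_k$ is attained (i.e. there is $p\in P_k$ with $d(x,p)=d(x,P_k)$). For each $k\in K$ let $Q_k=\operatorname{dom}(P_k,\bigcup_{j\neq k}P_j)$ and $Y_k=\{C: C\text{ is closed and }P_k\subseteq C\subseteq Q_k\}$. Let $Y=\prod_{k\in K}Y_k$, endowed with the uniform Hausdorff metric $\widetilde{D}((S_k)_{k\in K},(S'_k)_{k\in K})=\sup\{D(S_k,S'_k):k\in K\}$. Then the mapping $\operatorname{Dom}$, defined by $$\operatorname{Dom}\big((S_k)_{k\in K}\big)=\Big(\operatorname{dom}\Big(P_k,\bigcup_{j\neq k}S_j\Big)\Big)_{k\in K},$$ maps $Y$ into itself and is uniformly continuous on $Y$ (with respect to $\widetilde{D}$).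
   Context: Normed spaces may be real or complex, finite or infinite dimensional; $d(x,y)=|x-y|$ is the induced metric, $d(x,A)=\inf\{d(x,a):a\in A\}$, and $d(A_1,A_2)=\inf\{d(a_1,a_2):a_1\in A_1,a_2\in A_2\}$. $B(x,r)$ is the open ball of center $x$ and radius $r$. A normed space is uniformly convex if for every $\epsilon\in(0,2]$ there is $\delta\in(0,1]$ such that $|x|=|y|=1$ and $|x-y|\ge\epsilon$ imply $|(x+y)/2|\le 1-\delta$. Dominance region: for nonempty $P,A\subseteq X$, $\operatorname{dom}(P,A)=\{x\in X: d(x,P)\le d(x,A)\}$. Hausdorff distance: for nonempty $A_1,A_2\subseteq X$, $D(A_1,A_2)=\max\{\sup_{a_1\in A_1}d(a_1,A_2),\ \sup_{a_2\in A_2}d(a_2,A_1)\}$. *)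

theory Defs
  imports "HOL-Analysis.Analysis"
begin

text \<open>
  A complex normed space is also a real normed space with the same norm, so
  \<^class>\<open>real_normed_vector\<close> covers both scalar fields; convexity and uniform convexity
  only involve real scalars. The distances \<open>d(x,A)\<close> and \<open>d(A,B)\<close> are the library's
  \<^const>\<open>infdist\<close> and \<^const>\<open>setdist\<close>, which agree with the infima for nonempty sets.
\<close>

definition uniformly_convex :: "'a::real_normed_vector itself \<Rightarrow> bool" where
  "uniformly_convex (T :: 'a itself) \<longleftrightarrow>
     (\<forall>\<epsilon>::real. 0 < \<epsilon> \<and> \<epsilon> \<le> 2 \<longrightarrow>
        (\<exists>\<delta>::real. 0 < \<delta> \<and> \<delta> \<le> 1 \<and>
           (\<forall>x y :: 'a. norm x = 1 \<and> norm y = 1 \<and> norm (x - y) \<ge> \<epsilon>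
              \<longrightarrow> norm ((1/2) *\<^sub>R (x + y)) \<le> 1 - \<delta>)))"

definition dominance_region :: "'a::metric_space set \<Rightarrow> 'a set \<Rightarrow> 'a set \<Rightarrow> 'a set" where
  "dominance_region X P A = {x \<in> X. infdist x P \<le> infdist x A}"

text \<open>
  The Hausdorff distance of unbounded sets may be infinite, so the suprema are taken in
  \<^typ>\<open>ennreal\<close>.
\<close>

definition hausdorff_dist :: "'a::metric_space set \<Rightarrow> 'a set \<Rightarrow> ennreal" where
  "hausdorff_dist A B =
     max (SUP a\<in>A. ennreal (infdist a B)) (SUP b\<in>B. ennreal (infdist b A))"

definition uniform_hausdorff_dist ::
    "'k set \<Rightarrow> ('k \<Rightarrow> 'a::metric_space set) \<Rightarrow> ('k \<Rightarrow> 'a set) \<Rightarrow> ennreal" where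
  "uniform_hausdorff_dist K S S' = (SUP k\<in>K. hausdorff_dist (S k) (S' k))"

definition others :: "'k set \<Rightarrow> ('k \<Rightarrow> 'a set) \<Rightarrow> 'k \<Rightarrow> 'a set" where
  "others K P k = (\<Union>j\<in>K - {k}. P j)"

definition admissible_sets ::
    "'a::metric_space set \<Rightarrow> 'k set \<Rightarrow> ('k \<Rightarrow> 'a set) \<Rightarrow> 'k \<Rightarrow> 'a set set" where
  "admissible_sets X K P k =
     {C. closed C \<and> P k \<subseteq> C \<and> C \<subseteq> dominance_region X (P k) (others K P k)}"

text \<open>
  Tuples indexed by \<open>K\<close> are extensional functions on \<open>K\<close>, i.e. elements of \<^const>\<open>PiE\<close>.
\<close>

definition admissible_tuples ::
    "'a::metric_space set \<Rightarrow> 'k set \<Rightarrow> ('k \<Rightarrow> 'a set) \<Rightarrow> ('k \<Rightarrow> 'a set) set" where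
  "admissible_tuples X K P = (\<Pi>\<^sub>E k\<in>K. admissible_sets X K P k)"

definition Dom ::
    "'a::metric_space set \<Rightarrow> 'k set \<Rightarrow> ('k \<Rightarrow> 'a set) \<Rightarrow> ('k \<Rightarrow> 'a set) \<Rightarrow> ('k \<Rightarrow> 'a set)" where
  "Dom X K P S = (\<lambda>k\<in>K. dominance_region X (P k) (others K S k))"

end

theory Submission
  imports Defs
begin

text \<open>
  Let \<open>x\<close> lie in the dominance region of \<open>P\<^sub>k\<close> with respect to \<open>A = \<Union>\<^bsub>j \<noteq> k\<^esub> S\<^sub>j\<close>, and let \<open>p\<close> be a
  point of \<open>P\<^sub>k\<close> nearest to \<open>x\<close>. If \<open>p\<close> is close to \<open>x\<close>, it approximates \<open>x\<close> within the perturbed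
  region. Otherwise move from \<open>x\<close> a fixed small distance towards \<open>p\<close>. The distance to \<open>P\<^sub>k\<close> drops
  by exactly that amount, and the distance to \<open>A\<close> drops by strictly less, with a uniform gap:
  near equality in the triangle inequality would, by uniform convexity, put some point of \<open>A\<close> close
  to \<open>p\<close>, whereas \<open>A\<close> stays away from \<open>P\<^sub>k\<close> since the sites are positively separated. The gap
  absorbs a small perturbation of \<open>A\<close>. The ball condition bounds \<open>d(x, p)\<close>, so that the gap is
  uniform in \<open>x\<close> and \<open>k\<close>.
\<close>

section \<open>Uniform convexity and the gap it produces\<close>

lemma norm_scaled_sum_le:
  fixes u v :: "'a::real_normed_vector"
  assumes "norm u = 1" "norm v = 1" "norm ((1/2) *\<^sub>R (u + v)) \<le> 1 - d"
    and "0 \<le> m" "m \<le> s" "m \<le> t"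
  shows "norm (s *\<^sub>R u + t *\<^sub>R v) \<le> s + t - 2 * m * d"
proof -
  \<comment> \<open>The common part \<open>m\<close> of both coefficients goes through the midpoint
    and gains \<open>2 * m * d\<close>; the rest is bounded by the triangle inequality.\<close>
  have "s *\<^sub>R u + t *\<^sub>R v = (2 * m) *\<^sub>R ((1/2) *\<^sub>R (u + v)) + (s - m) *\<^sub>R u + (t - m) *\<^sub>R v"
    by (simp add: algebra_simps)
  also have "norm \<dots> \<le> norm ((2 * m) *\<^sub>R ((1/2) *\<^sub>R (u + v))) + norm ((s - m) *\<^sub>R u)
      + norm ((t - m) *\<^sub>R v)"
    by (rule order_trans[OF norm_triangle_ineq add_right_mono[OF norm_triangle_ineq]])
  also have "\<dots> = 2 * m * norm ((1/2) *\<^sub>R (u + v)) + (s - m) + (t - m)"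
    using assms by simp
  also have "\<dots> \<le> 2 * m * (1 - d) + (s - m) + (t - m)"
    using assms by (intro add_right_mono mult_left_mono) auto
  finally show ?thesis by (simp add: algebra_simps)
qed

text \<open>Compare the directions \<open>u\<close> from \<open>x\<close> to \<open>p\<close> and
  \<open>v\<close> from \<open>y\<close> to \<open>a\<close>. If they differ by at least
  \<open>\<eta>\<close>, convexity shortens the path from \<open>x\<close> through \<open>y\<close>
  to \<open>a\<close> by \<open>e * d\<close>; otherwise \<open>a\<close> falls within
  \<open>r\<close> of \<open>p\<close>. As \<open>\<gamma>\<close> depends only on \<open>e\<close>,
  \<open>r\<close>, \<open>\<rho>\<close>, one value serves all points and indices.\<close>

lemma uniformly_convex_shift_gap:
  fixes e r \<rho> :: real
  assumes uc: "uniformly_convex TYPE('a::real_normed_vector)" and e: "0 < e" and r: "0 < r"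
    and \<rho>: "0 < \<rho>"
  obtains \<gamma> where "0 < \<gamma>"
    "\<And>x p a y :: 'a. \<lbrakk>e < dist x p; dist x p \<le> \<rho>; dist x p \<le> dist x a; r \<le> dist p a;
        y = x + (e / 2 / dist x p) *\<^sub>R (p - x)\<rbrakk> \<Longrightarrow> dist x p - e / 2 + \<gamma> \<le> dist y a"
proof -
  \<comment> \<open>The cap 2 is the range of uniform convexity. The other bound makes directions
    less than \<open>\<eta>\<close> apart diverge by at most \<open>r / 2\<close> over a length up
    to \<open>\<rho>\<close>.\<close>
  define \<eta> where "\<eta> = min 2 (r / (2 * \<rho>))"
  have "\<rho> * \<eta> \<le> \<rho> * (r / (2 * \<rho>))" unfolding \<eta>_def using \<rho> by (intro mult_left_mono) auto
  with \<rho> have \<rho>\<eta>: "\<rho> * \<eta> \<le> r / 2" by simp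
  have \<eta>: "0 < \<eta>" "\<eta> \<le> 2" using r \<rho> by (simp_all add: \<eta>_def)
  with uc obtain d where "0 < d \<and> d \<le> 1 \<and> (\<forall>u v :: 'a. norm u = 1 \<and> norm v = 1 \<and>
      norm (u - v) \<ge> \<eta> \<longrightarrow> norm ((1/2) *\<^sub>R (u + v)) \<le> 1 - d)"
    unfolding uniformly_convex_def by meson
  then have d: "0 < d" and
    dd: "\<And>u v :: 'a. norm u = 1 \<Longrightarrow> norm v = 1 \<Longrightarrow> \<eta> \<le> norm (u - v) \<Longrightarrow>
      norm ((1/2) *\<^sub>R (u + v)) \<le> 1 - d"
    by auto
  define \<gamma> where "\<gamma> = min (e * d) (r / 2)"
  have \<gamma>: "0 < \<gamma>" "\<gamma> \<le> e * d" "\<gamma> \<le> r / 2"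
    using e d r by (auto simp: \<gamma>_def)
  show thesis
  proof (rule that[OF \<gamma>(1)])
    fix x p a y :: 'a
    assume R: "e < dist x p" "dist x p \<le> \<rho>" and xa: "dist x p \<le> dist x a" and pa: "r \<le> dist p a"
      and y: "y = x + (e / 2 / dist x p) *\<^sub>R (p - x)"
    define R where "R = dist x p"
    define u where "u = (1 / R) *\<^sub>R (p - x)"
    define w where "w = a - y"
    define v where "v = (1 / norm w) *\<^sub>R w"
    have R0: "e < R" "R \<le> \<rho>" "0 < R" using R e by (auto simp: R_def)
    have nu: "norm u = 1"
      using R0 by (simp add: u_def R_def dist_norm norm_minus_commute)
    have yu: "y = x + (e / 2) *\<^sub>R u" and pu: "p = x + R *\<^sub>R u"
      using R0 by (simp_all add: y u_def R_def)
    have aw: "a - x = (e / 2) *\<^sub>R u + w" by (simp add: w_def yu)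
    have "R \<le> norm (a - x)" using xa by (simp add: R_def dist_norm norm_minus_commute)
    also have "\<dots> \<le> norm ((e / 2) *\<^sub>R u) + norm w" unfolding aw by (rule norm_triangle_ineq)
    also have "\<dots> = e / 2 + norm w" using e nu by simp
    finally have w_ge: "R - e / 2 \<le> norm w" by simp
    with R0 e have w0: "0 < norm w" by linarith
    have nv: "norm v = 1" and wv: "w = norm w *\<^sub>R v"
      using w0 by (auto simp: v_def)
    have "R - e / 2 + \<gamma> \<le> norm w"
    proof (rule ccontr)
      assume "\<not> ?thesis"
      then have lt: "norm w < R - e / 2 + \<gamma>" by simp
      show False
      proof (cases "\<eta> \<le> norm (u - v)")
        case True
        \<comment> \<open>Here \<open>m = e / 2\<close>: since \<open>R > e\<close>, also
          \<open>norm w \<ge> R - e / 2 \<ge> e / 2\<close>.\<close>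
        have "norm ((e / 2) *\<^sub>R u + norm w *\<^sub>R v) \<le> e / 2 + norm w - 2 * (e / 2) * d"
          using dd[OF nu nv True] w_ge R0 e
          by (intro norm_scaled_sum_le nu nv) auto
        then have "norm (a - x) \<le> e / 2 + norm w - e * d" using wv aw by simp
        with \<open>R \<le> norm (a - x)\<close> lt \<gamma> show False by linarith
      next
        case False
        \<comment> \<open>Seen from \<open>y\<close>, \<open>p\<close> lies at length
          \<open>R - e / 2\<close> along \<open>u\<close> and \<open>a\<close> at length
          \<open>norm w\<close> along \<open>v\<close>. The lengths differ by less than
          \<open>\<gamma>\<close>, so \<open>a\<close> and \<open>p\<close> are less than
          \<open>\<gamma> + \<rho> * \<eta> \<le> r\<close> apart.\<close>
        have "a - p = w - (R - e / 2) *\<^sub>R u"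
          by (simp add: w_def yu pu algebra_simps)
        also have "\<dots> = (norm w - (R - e / 2)) *\<^sub>R v + (R - e / 2) *\<^sub>R (v - u)"
          by (subst wv) (simp add: algebra_simps)
        also have "norm \<dots> \<le> norm ((norm w - (R - e / 2)) *\<^sub>R v) + norm ((R - e / 2) *\<^sub>R (v - u))"
          by (rule norm_triangle_ineq)
        also have "\<dots> = (norm w - (R - e / 2)) + (R - e / 2) * norm (u - v)"
          using nv w_ge R0 e by (simp add: norm_minus_commute)
        also have "\<dots> < \<gamma> + \<rho> * \<eta>"
        proof (rule add_less_le_mono)
          show "(R - e / 2) * norm (u - v) \<le> \<rho> * \<eta>"
            using False R0 e \<rho> by (intro mult_mono) auto
        qed (use lt in simp)
        finally show False
          using pa \<gamma> \<rho>\<eta> by (simp add: dist_norm norm_minus_commute)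
      qed
    qed
    then show "dist x p - e / 2 + \<gamma> \<le> dist y a"
      by (simp add: R_def w_def dist_norm norm_minus_commute)
  qed
qed

section \<open>The uniform Hausdorff distance\<close>

lemma infdist_less_of_uniform_hausdorff_dist:
  assumes "uniform_hausdorff_dist K S S' < ennreal d" "k \<in> K"
  shows "a \<in> S k \<Longrightarrow> infdist a (S' k) < d" "a \<in> S' k \<Longrightarrow> infdist a (S k) < d"
proof -
  have "hausdorff_dist (S k) (S' k) < ennreal d"
    using assms unfolding uniform_hausdorff_dist_def
    by (meson SUP_upper le_less_trans)
  then have *: "(SUP a\<in>S k. ennreal (infdist a (S' k))) < ennreal d"
    "(SUP a\<in>S' k. ennreal (infdist a (S k))) < ennreal d"
    by (auto simp: hausdorff_dist_def)
  show "infdist a (S' k) < d" if "a \<in> S k"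
    using le_less_trans[OF SUP_upper[OF that] *(1)] by (simp add: ennreal_less_iff infdist_nonneg)
  show "infdist a (S k) < d" if "a \<in> S' k"
    using le_less_trans[OF SUP_upper[OF that] *(2)] by (simp add: ennreal_less_iff infdist_nonneg)
qed

lemma uniform_hausdorff_dist_le:
  assumes "\<And>k a. k \<in> K \<Longrightarrow> a \<in> S k \<Longrightarrow> infdist a (S' k) \<le> d"
    and "\<And>k a. k \<in> K \<Longrightarrow> a \<in> S' k \<Longrightarrow> infdist a (S k) \<le> d"
  shows "uniform_hausdorff_dist K S S' \<le> ennreal d"
  unfolding uniform_hausdorff_dist_def hausdorff_dist_def
  using assms by (auto intro!: SUP_least ennreal_leI)

lemma uniform_hausdorff_dist_commute:
  "uniform_hausdorff_dist K S S' = uniform_hausdorff_dist K S' S"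
  by (simp add: uniform_hausdorff_dist_def hausdorff_dist_def max.commute)

section \<open>Dominance regions and admissible tuples\<close>

lemma closed_dominance_region:
  assumes "closed X"
  shows "closed (dominance_region X P A)"
proof -
  have "dominance_region X P A = X \<inter> {x. infdist x P \<le> infdist x A}"
    by (auto simp: dominance_region_def)
  then show ?thesis
    using assms by (simp add: closed_Int closed_Collect_le continuous_on_infdist)
qed

lemma others_mono:
  assumes "\<And>j. j \<in> K \<Longrightarrow> P j \<subseteq> S j"
  shows "others K P k \<subseteq> others K S k"
  using assms by (fastforce simp: others_def)

text \<open>One half of Hausdorff closeness suffices, with one \<open>d\<close> for all indices, so
  it survives the union. Nonemptiness excludes the default \<open>infdist y {} = 0\<close>.\<close>

lemma infdist_others_le:
  assumes ne: "others K S' k \<noteq> {}" "\<And>j. j \<in> K \<Longrightarrow> S j \<noteq> {}"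
    and near: "\<And>j a. j \<in> K \<Longrightarrow> a \<in> S' j \<Longrightarrow> infdist a (S j) \<le> d"
  shows "infdist y (others K S k) \<le> infdist y (others K S' k) + d"
proof -
  have "infdist y (others K S k) - d \<le> infdist y (others K S' k)"
    unfolding infdist_notempty[OF ne(1)]
  proof (rule cINF_greatest[OF ne(1)])
    fix a assume "a \<in> others K S' k"
    then obtain j where j: "j \<in> K" "j \<noteq> k" "a \<in> S' j" by (auto simp: others_def)
    have "infdist y (others K S k) \<le> infdist y (S j)"
      using j ne by (intro infdist_mono) (auto simp: others_def)
    also have "\<dots> \<le> infdist a (S j) + dist y a" by (rule infdist_triangle)
    also have "\<dots> \<le> d + dist y a" using near j by simp
    finally show "infdist y (others K S k) - d \<le> dist y a" by simp
  qed
  then show ?thesis by simp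
qed

lemma admissible_tuplesD:
  assumes "S \<in> admissible_tuples X K P" "j \<in> K"
  shows "P j \<subseteq> S j" "S j \<subseteq> dominance_region X (P j) (others K P j)"
  using assms by (auto simp: admissible_tuples_def admissible_sets_def dest: PiE_mem)

lemma Dom_admissible:
  assumes X: "closed X" and P: "\<And>k. k \<in> K \<Longrightarrow> P k \<subseteq> X"
    and ne: "\<And>k. k \<in> K \<Longrightarrow> others K P k \<noteq> {}"
    and S: "S \<in> admissible_tuples X K P"
  shows "Dom X K P S \<in> admissible_tuples X K P"
proof -
  have "dominance_region X (P k) (others K S k) \<in> admissible_sets X K P k" if k: "k \<in> K" for k
  proof -
    \<comment> \<open>Enlarging the competing set shrinks the region, which keeps it inside the one
      for the sites.\<close>
    have "others K P k \<subseteq> others K S k"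
      using admissible_tuplesD(1)[OF S] by (rule others_mono)
    then have "infdist x (others K S k) \<le> infdist x (others K P k)" for x
      using ne[OF k] by (rule infdist_mono)
    then show ?thesis
      using P[OF k] closed_dominance_region[OF X, of "P k" "others K S k"]
      by (auto simp: admissible_sets_def dominance_region_def
            infdist_nonneg intro: order_trans)
  qed
  then show ?thesis by (simp add: admissible_tuples_def Dom_def)
qed

text \<open>The point \<open>a\<close> is at least as close to \<open>P j\<close> as to
  \<open>p\<close>. With \<open>q\<close> nearest to \<open>a\<close> in \<open>P j\<close>, the
  path from \<open>p\<close> through \<open>a\<close> to \<open>q\<close> has length at least
  \<open>r\<close> and at most \<open>2 * dist p a\<close>.\<close>

lemma dist_site_admissible_ge:
  assumes S: "S \<in> admissible_tuples X K P" and jk: "j \<in> K" "k \<in> K" "j \<noteq> k"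
    and sep: "r \<le> setdist (P k) (P j)"
    and attained: "\<And>x. x \<in> X \<Longrightarrow> \<exists>q\<in>P j. dist x q = infdist x (P j)"
    and p: "p \<in> P k" and a: "a \<in> S j"
  shows "r / 2 \<le> dist p a"
proof -
  have aX: "a \<in> X" and "infdist a (P j) \<le> infdist a (others K P j)"
    using admissible_tuplesD(2)[OF S jk(1)] a by (auto simp: dominance_region_def)
  moreover have "infdist a (others K P j) \<le> dist a p"
    using jk p by (intro infdist_le) (auto simp: others_def)
  moreover obtain q where q: "q \<in> P j" "dist a q = infdist a (P j)"
    using attained[OF aX] by blast
  moreover have "r \<le> dist p q" using sep setdist_le_dist[OF p q(1)] by simp
  moreover have "dist p q \<le> dist p a + dist a q" by (rule dist_triangle)
  ultimately show ?thesis by (simp add: dist_commute)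
qed

lemma dominance_region_approx:
  fixes X :: "'a::real_normed_vector set"
  assumes X: "convex X" and PX: "P \<subseteq> X" and e: "0 < e"
    and gap: "\<And>x p a y :: 'a. \<lbrakk>e < dist x p; dist x p \<le> \<rho>; dist x p \<le> dist x a; r \<le> dist p a;
        y = x + (e / 2 / dist x p) *\<^sub>R (p - x)\<rbrakk> \<Longrightarrow> dist x p - e / 2 + \<gamma> \<le> dist y a"
    and x: "x \<in> dominance_region X P A" and A: "A \<noteq> {}" and x\<rho>: "infdist x A \<le> \<rho>"
    and p: "p \<in> P" "dist x p = infdist x P"
    and sep: "\<And>a. a \<in> A \<Longrightarrow> r \<le> dist p a"
    and near: "\<And>y. infdist y A \<le> infdist y A' + \<gamma>"
  shows "infdist x (dominance_region X P A') \<le> e"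
proof -
  have xX: "x \<in> X" and xA: "dist x p \<le> infdist x A"
    using x p by (auto simp: dominance_region_def)
  have pX: "p \<in> X" using p PX by auto
  show ?thesis
  proof (cases "dist x p \<le> e")
    case True
    have "p \<in> dominance_region X P A'"
      using p pX by (simp add: dominance_region_def infdist_nonneg)
    then show ?thesis using True by (rule infdist_le2)
  next
    case False
    \<comment> \<open>The fraction of the segment of length \<open>e / 2\<close>; it is below 1, so
      convexity keeps \<open>y\<close> in \<open>X\<close>.\<close>
    define t where "t = e / 2 / dist x p"
    define y where "y = x + t *\<^sub>R (p - x)"
    have R: "e < dist x p" "0 < dist x p" using False e by auto
    have t: "0 < t" "t < 1" "t * dist x p = e / 2" using R e by (auto simp: t_def field_simps)
    have "y = (1 - t) *\<^sub>R x + t *\<^sub>R p" by (simp add: y_def algebra_simps)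
    then have yX: "y \<in> X" using convexD[OF X xX pX] t by simp
    have xy: "dist x y = e / 2"
      using t by (simp add: y_def dist_norm norm_minus_commute)
    have "y - p = (1 - t) *\<^sub>R (x - p)" by (simp add: y_def algebra_simps)
    then have "dist y p = (1 - t) * dist x p" using t by (simp add: dist_norm)
    then have yp: "dist y p = dist x p - e / 2" using t by (simp add: left_diff_distrib)
    have "dist x p - e / 2 + \<gamma> \<le> dist y a" if a: "a \<in> A" for a
    proof (rule gap)
      show "dist x p \<le> dist x a" using xA infdist_le[OF a] by (rule order_trans)
    qed (use R xA x\<rho> sep a in \<open>auto simp: y_def t_def\<close>)
    then have "dist x p - e / 2 + \<gamma> \<le> infdist y A"
      unfolding infdist_notempty[OF A] by (intro cINF_greatest A)
    \<comment> \<open>The surplus \<open>\<gamma>\<close> pays for replacing \<open>A\<close> by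
      \<open>A'\<close>.\<close>
    with near[of y] have "dist x p - e / 2 \<le> infdist y A'" by simp
    with yp infdist_le[OF p(1), of y] have "infdist y P \<le> infdist y A'" by simp
    with yX have "y \<in> dominance_region X P A'" by (simp add: dominance_region_def)
    then show ?thesis using xy e by (intro infdist_le2) auto
  qed
qed

section \<open>Self-mapping and uniform continuity of \<open>Dom\<close>\<close>

theorem proposition6p1:
  fixes X :: "'a::real_normed_vector set" and K :: "'k set" and P :: "'k \<Rightarrow> 'a set"
    and \<rho> :: real
  assumes "uniformly_convex TYPE('a)"
    and "X \<noteq> {}" and "closed X" and "convex X"
    and "\<exists>j\<in>K. \<exists>k\<in>K. j \<noteq> k"
    and "\<And>k. k \<in> K \<Longrightarrow> P k \<noteq> {} \<and> P k \<subseteq> X"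
    and "Inf {setdist (P k) (P j) | j k. j \<in> K \<and> k \<in> K \<and> j \<noteq> k} > 0"
    and "\<rho> > 0"
    and "\<And>k x. k \<in> K \<Longrightarrow> x \<in> X \<Longrightarrow> ball x \<rho> \<inter> others K P k \<noteq> {}"
    and "\<And>k x. k \<in> K \<Longrightarrow> x \<in> X \<Longrightarrow> \<exists>p\<in>P k. dist x p = infdist x (P k)"
  shows "Dom X K P \<in> admissible_tuples X K P \<rightarrow> admissible_tuples X K P \<and>
    (\<forall>\<epsilon>::real. \<epsilon> > 0 \<longrightarrow> (\<exists>\<delta>::real. \<delta> > 0 \<and>
       (\<forall>S \<in> admissible_tuples X K P. \<forall>S' \<in> admissible_tuples X K P.
          uniform_hausdorff_dist K S S' < ennreal \<delta> \<longrightarrow>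
          uniform_hausdorff_dist K (Dom X K P S) (Dom X K P S') < ennreal \<epsilon>)))"
proof (intro conjI allI impI)
  have ne: "others K P k \<noteq> {}" if "k \<in> K" for k using that assms(2,9) by blast
  show "Dom X K P \<in> admissible_tuples X K P \<rightarrow> admissible_tuples X K P"
    using assms(3,6) ne by (intro funcsetI Dom_admissible) auto
  fix \<epsilon> :: real assume \<epsilon>: "0 < \<epsilon>"
  \<comment> \<open>Pointwise bounds give only a weak bound on the supremum; halving restores
    strictness.\<close>
  define e where "e = \<epsilon> / 2"
  have e: "0 < e" "e < \<epsilon>" using \<epsilon> by (auto simp: e_def)
  define r where "r = Inf {setdist (P k) (P j) | j k. j \<in> K \<and> k \<in> K \<and> j \<noteq> k}"
  have r: "0 < r / 2" using assms(7) by (simp add: r_def)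
  have sep: "r \<le> setdist (P k) (P j)" if "j \<in> K" "k \<in> K" "j \<noteq> k" for j k
    unfolding r_def using that by (intro cInf_lower bdd_belowI[of _ 0]) auto
  \<comment> \<open>Points of \<open>S j\<close> keep half the separation of the sites, hence
    \<open>r / 2\<close>.\<close>
  obtain \<gamma> where \<gamma>: "0 < \<gamma>" and
    gap: "\<And>x p a y :: 'a. \<lbrakk>e < dist x p; dist x p \<le> \<rho>; dist x p \<le> dist x a; r / 2 \<le> dist p a;
        y = x + (e / 2 / dist x p) *\<^sub>R (p - x)\<rbrakk> \<Longrightarrow> dist x p - e / 2 + \<gamma> \<le> dist y a"
    using uniformly_convex_shift_gap[OF assms(1) e(1) r assms(8)] by blast
  have approx: "infdist x (Dom X K P S' k) \<le> e"
    if S: "S \<in> admissible_tuples X K P" and S': "S' \<in> admissible_tuples X K P"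
      and D: "uniform_hausdorff_dist K S S' < ennreal \<gamma>" and k: "k \<in> K"
      and x: "x \<in> Dom X K P S k" for S S' k x
  proof -
    have xd: "x \<in> dominance_region X (P k) (others K S k)" using x k by (simp add: Dom_def)
    then have xX: "x \<in> X" by (simp add: dominance_region_def)
    obtain p where p: "p \<in> P k" "dist x p = infdist x (P k)" using assms(10)[OF k xX] by blast
    have PS: "others K P k \<subseteq> others K S k" and PS': "others K P k \<subseteq> others K S' k"
      using admissible_tuplesD(1) S S' by (metis others_mono)+
    \<comment> \<open>The sites lie inside \<open>S\<close>, so the ball condition bounds the
      distance to \<open>others K S k\<close> by \<open>\<rho>\<close>, whatever \<open>S\<close>
      is.\<close>
    obtain b where b: "b \<in> others K P k" "dist x b < \<rho>" using assms(9)[OF k xX] by auto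
    show ?thesis
      unfolding Dom_def restrict_apply'[OF k]
    proof (rule dominance_region_approx[OF assms(4) _ e(1) gap xd _ _ p])
      show "infdist x (others K S k) \<le> \<rho>"
        using b PS by (intro infdist_le2[of b]) auto
      show "r / 2 \<le> dist p a" if "a \<in> others K S k" for a
        using that dist_site_admissible_ge[OF S _ k _ sep[OF _ k] assms(10) p(1)]
        by (auto simp: others_def)
      show "infdist y (others K S k) \<le> infdist y (others K S' k) + \<gamma>" for y
        using PS' ne[OF k] assms(6) admissible_tuplesD(1)[OF S]
          infdist_less_of_uniform_hausdorff_dist(2)[OF D]
        by (intro infdist_others_le) (blast, blast, force)
    qed (use assms(6)[OF k] PS ne[OF k] in auto)
  qed
  have "uniform_hausdorff_dist K (Dom X K P S) (Dom X K P S') < ennreal \<epsilon>"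
    if "S \<in> admissible_tuples X K P" "S' \<in> admissible_tuples X K P"
      "uniform_hausdorff_dist K S S' < ennreal \<gamma>" for S S'
  proof (rule le_less_trans)
    \<comment> \<open>By symmetry \<open>approx\<close> applies to both orders of \<open>S\<close>
      and \<open>S'\<close>, covering both suprema.\<close>
    show "uniform_hausdorff_dist K (Dom X K P S) (Dom X K P S') \<le> ennreal e"
      using that by (intro uniform_hausdorff_dist_le)
        (auto intro: approx simp: uniform_hausdorff_dist_commute[of K S' S])
    show "ennreal e < ennreal \<epsilon>" using e by (simp add: ennreal_lessI)
  qed
  with \<gamma> show "\<exists>\<delta>>0. \<forall>S\<in>admissible_tuples X K P. \<forall>S'\<in>admissible_tuples X K P.
      uniform_hausdorff_dist K S S' < ennreal \<delta> \<longrightarrow>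
      uniform_hausdorff_dist K (Dom X K P S) (Dom X K P S') < ennreal \<epsilon>"
    by blast
qed

end
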